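(* (1) The maximal block size statistic $\mathrm{maxBk}$ and the minimal block size statistic $\mathrm{minBk}$ are shuffle-compatible on set partitions. (2) The linear map on $\mathcal{A}^{\Psi}_{\mathrm{maxBk}}$ defined by $[\pi]^\Psi_{\mathrm{maxBk}}\mapsto[f(\pi)]^{\mathrm{PF}}_{\mathrm{maxDisp}}$, where $f(\pi)=(1)^{\mathrm{maxBk}(\pi)}\cdot(\mathrm{maxBk}(\pi)+1,\dots,|\pi|-1,|\pi|)\in\mathrm{PF}_{|\pi|}$, is an algebra isomorphism from $\mathcal{A}^{\Psi}_{\mathrm{maxBk}}$ to $\mathcal{A}^{\mathrm{PF}}_{\mathrm{maxDisp}}$.
   Context: All algebras are over $\mathbb{Q}$. $(1)^k$ denotes the word of $k$ ones, and $\cdot$ is concatenation. Set partitions: $\Psi$ is the set of all set partitions of finite subsets of $\{1,2,3,\dots\}$; for $\pi\in\Psi$ a partition of $I$ (written $\pi\vdash I$), $|\pi|=|I|$. Set partitions $\tau\vdash I,\theta\vdash J$ are disjoint if $I\cap J=\emptyset$. For $\pi\vdash\{i_1<\dots<i_n\}$ and $S=\{s_1<\dots<s_n\}$, $\mathrm{shift}_S(\pi)$ is the set partition of $S$ obtained by replacing each $i_j$ by $s_j$; $\mathrm{std}(\pi)=\mathrm{shift}_{[n]}(\pi)$. For disjoint $\tau\vdash I,\theta\vdash J$ the arc-shuffle is the multiset (indexed by $S$) $\mathrm{ASh}(\tau,\theta)=\{\{\mathrm{shift}_S(\tau)\cup\mathrm{shift}_{(I\cup J)\setminus S}(\theta):S\subseteq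 I\cup J,|S|=|I|\}\}$. $\mathrm{maxBk}(\pi)$ and $\mathrm{minBk}(\pi)$ are the largest and smallest block sizes of $\pi$ (value $0$ for the empty partition). A statistic $\mathrm{st}$ on $\Psi$ is shuffle-compatible on set partitions if (i) for all disjoint $\tau,\theta\in\Psi$ the multiset $\{\{\mathrm{st}(\pi):\pi\in\mathrm{ASh}(\tau,\theta)\}\}$ is determined by $\mathrm{st}(\tau),\mathrm{st}(\theta),|\tau|,|\theta|$; and (ii) $\mathrm{std}(\tau)=\mathrm{std}(\theta)$ implies $\mathrm{st}(\tau)=\mathrm{st}(\theta)$. With $[\pi]^\Psi_{\mathrm{st}}=\{\tau\in\Psi:\mathrm{st}(\tau)=\mathrm{st}(\pi),|\tau|=|\pi|\}$, $\mathcal{A}^\Psi_{\mathrm{st}}$ is the algebra with basis these classes and product $[\tau]^\Psi_{\mathrm{st}}[\theta]^\Psi_{\mathrm{st}}=\sum_{\pi\in\mathrm{ASh}(\tau,\theta)}[\pi]^\Psi_{\mathrm{st}}$ (with multiplicity), for disjoint representatives. Parking functions: $\mathrm{PF}_n$ is the set of sequences $\alpha=(\alpha_1,\dots,\alpha_n)$ of positive integers whose weakly increasing rearrangement satisfies $\alpha'_i\le i$; $\mathrm{PF}=\bigcup_{n\ge0}\mathrm{PF}_n$. Cars $1,\dots,n$ arrive in order on a one-way street with spots $1,\dots,n$; car $i$ parks in the first unoccupied spot $s_i\ge\alpha_i$. $\mathrm{maxDisp}(\alpha)=\max\{s_1-\alpha_1,\dots,s_n-\alpha_n\}$ ($0$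 for the empty parking function). For $\alpha\in\mathrm{PF}_n,\beta\in\mathrm{PF}$, $\overrightarrow{\mathrm{Sh}}(\alpha,\beta)$ is the set of all interleavings of $\alpha$ with $\beta[n]$ ($\beta$ with $n$ added to each entry). With $[\alpha]^{\mathrm{PF}}_{\mathrm{maxDisp}}=\{\beta\in\mathrm{PF}:\mathrm{maxDisp}(\beta)=\mathrm{maxDisp}(\alpha),|\beta|=|\alpha|\}$, $\mathcal{A}^{\mathrm{PF}}_{\mathrm{maxDisp}}$ is the algebra with basis these classes and product $[\alpha]^{\mathrm{PF}}_{\mathrm{maxDisp}}[\beta]^{\mathrm{PF}}_{\mathrm{maxDisp}}=\sum_{\gamma\in\overrightarrow{\mathrm{Sh}}(\alpha,\beta)}[\gamma]^{\mathrm{PF}}_{\mathrm{maxDisp}}$; this is well defined because the multiset of $\mathrm{maxDisp}$ values over $\overrightarrow{\mathrm{Sh}}(\alpha,\beta)$ is determined by $\mathrm{maxDisp}(\alpha),\mathrm{maxDisp}(\beta),|\alpha|,|\beta|$. *)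

theory Defs
  imports
    Complex_Main
    "HOL-Library.Poly_Mapping"
    "HOL-Library.Multiset"
    "HOL-Library.Disjoint_Sets"
    "HOL-Algebra.Module"
    "HOL-Algebra.QuotRing"
begin

section \<open>Rational algebras with a distinguished basis\<close>

definition basis :: "'c \<Rightarrow> 'c \<Rightarrow>\<^sub>0 rat" where
  "basis C = Poly_Mapping.single C 1"

definition scale :: "rat \<Rightarrow> ('c \<Rightarrow>\<^sub>0 rat) \<Rightarrow> ('c \<Rightarrow>\<^sub>0 rat)" where
  "scale c a = Poly_Mapping.map (\<lambda>x. c * x) a"

text \<open>The rational vector space of finite formal linear combinations of elements of \<open>X\<close>,
  with the bilinear product that is given on basis elements by \<open>p\<close>, and with unit the basis
  element \<open>u\<close>. The scalars are the whole type \<^typ>\<open>rat\<close>.\<close>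

definition algebra_on :: "'c set \<Rightarrow> ('c \<Rightarrow> 'c \<Rightarrow> ('c \<Rightarrow>\<^sub>0 rat)) \<Rightarrow> 'c \<Rightarrow> (rat, 'c \<Rightarrow>\<^sub>0 rat) module" where
  "algebra_on X p u =
    \<lparr> carrier = {a. Poly_Mapping.keys a \<subseteq> X},
      monoid.mult = (\<lambda>a b. \<Sum>C\<in>Poly_Mapping.keys a. \<Sum>D\<in>Poly_Mapping.keys b.
        scale (Poly_Mapping.lookup a C * Poly_Mapping.lookup b D) (p C D)),
      one = basis u,
      ring.zero = 0,
      add = (+),
      smult = scale \<rparr>"

definition algebra_iso ::
    "(rat, 'a, 'm) module_scheme \<Rightarrow> (rat, 'b, 'n) module_scheme \<Rightarrow> ('a \<Rightarrow> 'b) set" where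
  "algebra_iso A B =
    {h \<in> ring_iso A B. \<forall>c. \<forall>a\<in>carrier A. h (c \<odot>\<^bsub>A\<^esub> a) = c \<odot>\<^bsub>B\<^esub> h a}"


section \<open>Set partitions\<close>

definition set_partitions :: "nat set set set" where
  "set_partitions = {\<pi>. \<exists>I. finite I \<and> 0 \<notin> I \<and> partition_on I \<pi>}"

definition psize :: "nat set set \<Rightarrow> nat" where
  "psize \<pi> = card (\<Union>\<pi>)"

text \<open>The increasing bijection from \<open>I\<close> to \<open>S\<close>, for finite sets of equal size: an element with
  \<open>k\<close> smaller elements in \<open>I\<close> goes to the entry of index \<open>k\<close> (counted from zero) of the
  increasing list of \<open>S\<close>.\<close>

definition relabel :: "nat set \<Rightarrow> nat set \<Rightarrow> nat \<Rightarrow> nat" where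
  "relabel I S i = sorted_list_of_set S ! card {j \<in> I. j < i}"

definition shift :: "nat set \<Rightarrow> nat set set \<Rightarrow> nat set set" where
  "shift S \<pi> = (\<lambda>B. relabel (\<Union>\<pi>) S ` B) ` \<pi>"

definition std :: "nat set set \<Rightarrow> nat set set" where
  "std \<pi> = shift {1..psize \<pi>} \<pi>"

definition disjoint_partitions :: "nat set set \<Rightarrow> nat set set \<Rightarrow> bool" where
  "disjoint_partitions \<tau> \<theta> \<longleftrightarrow> \<Union>\<tau> \<inter> \<Union>\<theta> = {}"

definition arc_shuffle :: "nat set set \<Rightarrow> nat set set \<Rightarrow> nat set set multiset" where
  "arc_shuffle \<tau> \<theta> =
    image_mset (\<lambda>S. shift S \<tau> \<union> shift ((\<Union>\<tau> \<union> \<Union>\<theta>) - S) \<theta>)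
      (mset_set {S. S \<subseteq> \<Union>\<tau> \<union> \<Union>\<theta> \<and> card S = card (\<Union>\<tau>)})"

definition maxBk :: "nat set set \<Rightarrow> nat" where
  "maxBk \<pi> = (if \<pi> = {} then 0 else Max (card ` \<pi>))"

definition minBk :: "nat set set \<Rightarrow> nat" where
  "minBk \<pi> = (if \<pi> = {} then 0 else Min (card ` \<pi>))"

definition shuffle_compatible :: "(nat set set \<Rightarrow> 's) \<Rightarrow> bool" where
  "shuffle_compatible st \<longleftrightarrow>
    (\<forall>\<tau>\<in>set_partitions. \<forall>\<theta>\<in>set_partitions. \<forall>\<tau>'\<in>set_partitions. \<forall>\<theta>'\<in>set_partitions.
      disjoint_partitions \<tau> \<theta> \<longrightarrow> disjoint_partitions \<tau>' \<theta>' \<longrightarrow>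
      st \<tau> = st \<tau>' \<longrightarrow> st \<theta> = st \<theta>' \<longrightarrow> psize \<tau> = psize \<tau>' \<longrightarrow> psize \<theta> = psize \<theta>' \<longrightarrow>
      image_mset st (arc_shuffle \<tau> \<theta>) = image_mset st (arc_shuffle \<tau>' \<theta>')) \<and>
    (\<forall>\<tau>\<in>set_partitions. \<forall>\<theta>\<in>set_partitions. std \<tau> = std \<theta> \<longrightarrow> st \<tau> = st \<theta>)"

definition psi_class :: "(nat set set \<Rightarrow> 's) \<Rightarrow> nat set set \<Rightarrow> nat set set set" where
  "psi_class st \<pi> = {\<tau> \<in> set_partitions. st \<tau> = st \<pi> \<and> psize \<tau> = psize \<pi>}"

text \<open>The product of two classes is the common value of the arc-shuffle sum over all pairs of
  disjoint representatives; see \<open>psi_prod_eq\<close> below.\<close>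

definition psi_prod ::
    "(nat set set \<Rightarrow> 's) \<Rightarrow> nat set set set \<Rightarrow> nat set set set \<Rightarrow> (nat set set set \<Rightarrow>\<^sub>0 rat)" where
  "psi_prod st C D = (THE x. \<forall>\<tau>\<in>C. \<forall>\<theta>\<in>D. disjoint_partitions \<tau> \<theta> \<longrightarrow>
      x = (\<Sum>\<pi>\<in>#arc_shuffle \<tau> \<theta>. basis (psi_class st \<pi>)))"

definition psi_algebra :: "(nat set set \<Rightarrow> 's) \<Rightarrow> (rat, nat set set set \<Rightarrow>\<^sub>0 rat) module" where
  "psi_algebra st =
    algebra_on (psi_class st ` set_partitions) (psi_prod st) (psi_class st {})"


section \<open>Parking functions\<close>

definition PF_n :: "nat \<Rightarrow> nat list set" where
  "PF_n n = {\<alpha>. length \<alpha> = n \<and> (\<forall>a\<in>set \<alpha>. 1 \<le> a) \<and> (\<forall>i<n. sort \<alpha> ! i \<le> i + 1)}"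

definition PF :: "nat list set" where
  "PF = (\<Union>n. PF_n n)"

text \<open>The spots taken by the cars, in order of arrival, when the spots in \<open>Occ\<close> are already
  occupied. The street is taken to be unbounded; for a parking function of length \<open>n\<close> only the
  spots \<open>1, \<dots>, n\<close> are ever used.\<close>

primrec park :: "nat set \<Rightarrow> nat list \<Rightarrow> nat list" where
  "park Occ [] = []"
| "park Occ (a # \<alpha>) =
    (let s = (LEAST s. a \<le> s \<and> s \<notin> Occ) in s # park (insert s Occ) \<alpha>)"

definition maxDisp :: "nat list \<Rightarrow> nat" where
  "maxDisp \<alpha> = (if \<alpha> = [] then 0 else Max (set (map2 (\<lambda>s a. s - a) (park {} \<alpha>) \<alpha>)))"

text \<open>The entries of \<open>\<alpha> \<in> PF_n n\<close> are at most \<open>n\<close> and those of the shifted word are larger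
  than \<open>n\<close>, so different interleavings give different words.\<close>

definition shifted_shuffle :: "nat list \<Rightarrow> nat list \<Rightarrow> nat list set" where
  "shifted_shuffle \<alpha> \<beta> = shuffles \<alpha> (map (\<lambda>b. b + length \<alpha>) \<beta>)"

definition pf_class :: "(nat list \<Rightarrow> 's) \<Rightarrow> nat list \<Rightarrow> nat list set" where
  "pf_class st \<alpha> = {\<beta> \<in> PF. st \<beta> = st \<alpha> \<and> length \<beta> = length \<alpha>}"

definition pf_prod ::
    "(nat list \<Rightarrow> 's) \<Rightarrow> nat list set \<Rightarrow> nat list set \<Rightarrow> (nat list set \<Rightarrow>\<^sub>0 rat)" where
  "pf_prod st C D = (THE x. \<forall>\<alpha>\<in>C. \<forall>\<beta>\<in>D.
      x = (\<Sum>\<gamma>\<in>shifted_shuffle \<alpha> \<beta>. basis (pf_class st \<gamma>)))"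

definition pf_algebra :: "(nat list \<Rightarrow> 's) \<Rightarrow> (rat, nat list set \<Rightarrow>\<^sub>0 rat) module" where
  "pf_algebra st = algebra_on (pf_class st ` PF) (pf_prod st) (pf_class st [])"

definition block_word :: "nat set set \<Rightarrow> nat list" where
  "block_word \<pi> = replicate (maxBk \<pi>) 1 @ [maxBk \<pi> + 1..<psize \<pi> + 1]"


section \<open>The products do not depend on the representatives\<close>

lemma bij_betw_relabel:
  assumes "finite I" "finite S" "card I = card S"
  shows "bij_betw (relabel I S) I S"
proof -
  have inj: "inj_on (\<lambda>i. card {j \<in> I. j < i}) I"
  proof (rule linorder_inj_onI)
    fix x y assume "x < y" "x \<in> I" "y \<in> I"
    then have "{j \<in> I. j < x} \<subset> {j \<in> I. j < y}" by auto
    then show "card {j \<in> I. j < x} \<noteq> card {j \<in> I. j < y}"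
      using assms(1) psubset_card_mono[of "{j \<in> I. j < y}" "{j \<in> I. j < x}"] by simp
  qed auto
  have lt: "card {j \<in> I. j < i} < card I" if "i \<in> I" for i
    using that assms(1) by (intro psubset_card_mono) auto
  have img: "(\<lambda>i. card {j \<in> I. j < i}) ` I = {..<card I}"
    by (rule card_subset_eq) (use lt inj in \<open>auto simp: card_image\<close>)
  have b1: "bij_betw (\<lambda>i. card {j \<in> I. j < i}) I {..<card I}"
    using inj img by (simp add: bij_betw_def)
  have b2: "bij_betw ((!) (sorted_list_of_set S)) {..<card I} S"
    by (rule bij_betw_nth) (use assms in auto)
  from bij_betw_trans[OF b1 b2] show ?thesis
    by (simp add: comp_def relabel_def[abs_def])
qed

lemma Union_shift:
  assumes "finite (\<Union>\<pi>)" "finite S" "card S = psize \<pi>"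
  shows "\<Union>(shift S \<pi>) = S"
proof -
  have "\<Union>(shift S \<pi>) = relabel (\<Union>\<pi>) S ` \<Union>\<pi>"
    by (auto simp: shift_def)
  also have "\<dots> = S"
    using bij_betw_relabel[of "\<Union>\<pi>" S] assms by (auto simp: psize_def bij_betw_def)
  finally show ?thesis .
qed

lemma finite_Union_partition: "\<pi> \<in> set_partitions \<Longrightarrow> finite (\<Union>\<pi>)"
  by (auto simp: set_partitions_def partition_on_def)

lemma psize_arc_shuffle:
  assumes "\<tau> \<in> set_partitions" "\<theta> \<in> set_partitions" "disjoint_partitions \<tau> \<theta>"
    and "\<pi> \<in># arc_shuffle \<tau> \<theta>"
  shows "psize \<pi> = psize \<tau> + psize \<theta>"
proof -
  let ?U = "\<Union>\<tau> \<union> \<Union>\<theta>"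
  have fin: "finite (\<Union>\<tau>)" "finite (\<Union>\<theta>)" using assms finite_Union_partition by blast+
  then have finU: "finite ?U" by blast
  then have "finite {S. S \<subseteq> ?U \<and> card S = card (\<Union>\<tau>)}" by simp
  with assms(4) obtain S where S: "S \<subseteq> ?U" "card S = card (\<Union>\<tau>)"
    and \<pi>: "\<pi> = shift S \<tau> \<union> shift (?U - S) \<theta>"
    unfolding arc_shuffle_def by auto
  have fS: "finite S" using S finU finite_subset by blast
  have cU: "card ?U = card (\<Union>\<tau>) + card (\<Union>\<theta>)"
    using assms(3) fin unfolding disjoint_partitions_def by (simp add: card_Un_disjoint)
  have "card (?U - S) = psize \<theta>"
    using card_Diff_subset[OF fS S(1)] S(2) cU by (simp add: psize_def)
  then have "\<Union>\<pi> = S \<union> (?U - S)"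
    using Union_shift[of \<tau> S] Union_shift[of \<theta> "?U - S"] fin fS finU S \<pi>
    by (simp add: psize_def)
  then have "\<Union>\<pi> = ?U" using S by blast
  then show ?thesis using cU by (simp add: psize_def)
qed

lemma psi_prod_eq:
  assumes "shuffle_compatible st" "\<tau> \<in> set_partitions" "\<theta> \<in> set_partitions"
    "disjoint_partitions \<tau> \<theta>"
  shows "psi_prod st (psi_class st \<tau>) (psi_class st \<theta>) =
    (\<Sum>\<pi>\<in>#arc_shuffle \<tau> \<theta>. basis (psi_class st \<pi>))"
proof -
  have red: "(\<Sum>\<pi>\<in>#arc_shuffle \<tau>' \<theta>'. basis (psi_class st \<pi>)) =
      (\<Sum>v\<in>#image_mset st (arc_shuffle \<tau>' \<theta>').
        basis {\<rho> \<in> set_partitions. st \<rho> = v \<and> psize \<rho> = psize \<tau>' + psize \<theta>'})"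
    if "\<tau>' \<in> set_partitions" "\<theta>' \<in> set_partitions" "disjoint_partitions \<tau>' \<theta>'" for \<tau>' \<theta>'
    unfolding multiset.map_comp comp_def
    by (rule arg_cong[where f=sum_mset], rule image_mset_cong)
       (simp add: psi_class_def psize_arc_shuffle[OF that])
  have eq: "(\<Sum>\<pi>\<in>#arc_shuffle \<tau>' \<theta>'. basis (psi_class st \<pi>)) =
      (\<Sum>\<pi>\<in>#arc_shuffle \<tau> \<theta>. basis (psi_class st \<pi>))"
    if "\<tau>' \<in> psi_class st \<tau>" "\<theta>' \<in> psi_class st \<theta>" "disjoint_partitions \<tau>' \<theta>'" for \<tau>' \<theta>'
  proof -
    have *: "\<tau>' \<in> set_partitions" "\<theta>' \<in> set_partitions" "st \<tau>' = st \<tau>" "st \<theta>' = st \<theta>"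
      "psize \<tau>' = psize \<tau>" "psize \<theta>' = psize \<theta>"
      using that by (auto simp: psi_class_def)
    have "image_mset st (arc_shuffle \<tau>' \<theta>') = image_mset st (arc_shuffle \<tau> \<theta>)"
      using assms(1)[unfolded shuffle_compatible_def, THEN conjunct1, rule_format, OF *(1,2) assms(2,3)
          that(3) assms(4) *(3-6)] .
    then show ?thesis
      by (simp only: red[OF *(1,2) that(3)] red[OF assms(2-4)] *(5,6))
  qed
  have mem: "\<tau> \<in> psi_class st \<tau>" "\<theta> \<in> psi_class st \<theta>"
    using assms by (auto simp: psi_class_def)
  show ?thesis
    unfolding psi_prod_def
  proof (rule the_equality, intro ballI impI)
    fix \<tau>' \<theta>' assume "\<tau>' \<in> psi_class st \<tau>" "\<theta>' \<in> psi_class st \<theta>" "disjoint_partitions \<tau>' \<theta>'"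
    then show "(\<Sum>\<pi>\<in>#arc_shuffle \<tau> \<theta>. basis (psi_class st \<pi>)) =
        (\<Sum>\<pi>\<in>#arc_shuffle \<tau>' \<theta>'. basis (psi_class st \<pi>))"
      by (rule eq[symmetric])
  qed (drule bspec[OF _ mem(1)], drule bspec[OF _ mem(2)], erule mp[OF _ assms(4)])
qed

lemma pf_prod_eq:
  assumes compatible: "\<And>\<alpha>' \<beta>'. \<alpha>' \<in> pf_class st \<alpha> \<Longrightarrow> \<beta>' \<in> pf_class st \<beta> \<Longrightarrow>
      image_mset st (mset_set (shifted_shuffle \<alpha>' \<beta>')) =
      image_mset st (mset_set (shifted_shuffle \<alpha> \<beta>))"
    and "\<alpha> \<in> PF" "\<beta> \<in> PF"
  shows "pf_prod st (pf_class st \<alpha>) (pf_class st \<beta>) =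
    (\<Sum>\<gamma>\<in>shifted_shuffle \<alpha> \<beta>. basis (pf_class st \<gamma>))"
proof -
  have red: "(\<Sum>\<gamma>\<in>shifted_shuffle \<alpha>' \<beta>'. basis (pf_class st \<gamma>)) =
      (\<Sum>v\<in>#image_mset st (mset_set (shifted_shuffle \<alpha>' \<beta>')).
        basis {\<rho> \<in> PF. st \<rho> = v \<and> length \<rho> = length \<alpha>' + length \<beta>'})" for \<alpha>' \<beta>'
    unfolding multiset.map_comp comp_def sum_unfold_sum_mset
    by (rule arg_cong[where f=sum_mset], rule image_mset_cong)
       (auto simp: pf_class_def shifted_shuffle_def length_shuffles)
  have eq: "(\<Sum>\<gamma>\<in>shifted_shuffle \<alpha>' \<beta>'. basis (pf_class st \<gamma>)) =
      (\<Sum>\<gamma>\<in>shifted_shuffle \<alpha> \<beta>. basis (pf_class st \<gamma>))"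
    if "\<alpha>' \<in> pf_class st \<alpha>" "\<beta>' \<in> pf_class st \<beta>" for \<alpha>' \<beta>'
  proof -
    have "length \<alpha>' = length \<alpha>" "length \<beta>' = length \<beta>"
      using that by (auto simp: pf_class_def)
    then show ?thesis
      by (simp only: red compatible[OF that])
  qed
  have mem: "\<alpha> \<in> pf_class st \<alpha>" "\<beta> \<in> pf_class st \<beta>"
    using assms(2,3) by (auto simp: pf_class_def)
  show ?thesis
    unfolding pf_prod_def
  proof (rule the_equality, intro ballI)
    fix \<alpha>' \<beta>' assume "\<alpha>' \<in> pf_class st \<alpha>" "\<beta>' \<in> pf_class st \<beta>"
    then show "(\<Sum>\<gamma>\<in>shifted_shuffle \<alpha> \<beta>. basis (pf_class st \<gamma>)) =
        (\<Sum>\<gamma>\<in>shifted_shuffle \<alpha>' \<beta>'. basis (pf_class st \<gamma>))"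
      by (rule eq[symmetric])
  qed (drule bspec[OF _ mem(1)], erule bspec[OF _ mem(2)])
qed

end

theory Submission
  imports Defs
begin

text \<open>On both sides the statistic is constant on a shuffle. The blocks of an arc-shuffle have the
  sizes of the blocks of the two factors, so \<open>maxBk\<close> and \<open>minBk\<close> of all terms are the maximum and
  minimum of the two values. In a shifted shuffle, a parking function of length \<open>n\<close> fills exactly
  the spots up to \<open>n\<close> and the shifted one only uses spots beyond \<open>n\<close>, so neither influences the
  displacements of the other and \<open>maxDisp\<close> of all terms is the maximum. Both products are thus
  \<open>(n + m choose n)\<close> times a single class, and the classes correspond through
  \<open>maxDisp = maxBk - 1\<close>.\<close>

section \<open>Pushing forward formal linear combinations\<close>

text \<open>The linear extension of a map between bases; taking \<open>F\<close> to be the bijection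
  of classes will give the isomorphism.\<close>

definition push :: "('a \<Rightarrow> 'b) \<Rightarrow> ('a \<Rightarrow>\<^sub>0 rat) \<Rightarrow> ('b \<Rightarrow>\<^sub>0 rat)" where
  "push F a = (\<Sum>C\<in>Poly_Mapping.keys a. Poly_Mapping.single (F C) (Poly_Mapping.lookup a C))"

text \<open>Terms outside the support vanish. Additivity needs one common index set, since
  cancellation can shrink the support of a sum.\<close>

lemma push_superset:
  assumes "finite K" "Poly_Mapping.keys a \<subseteq> K"
  shows "push F a = (\<Sum>C\<in>K. Poly_Mapping.single (F C) (Poly_Mapping.lookup a C))"
  unfolding push_def
  by (rule sum.mono_neutral_left) (use assms in \<open>auto simp: in_keys_iff\<close>)

lemma lookup_scale: "Poly_Mapping.lookup (scale c a) k = c * Poly_Mapping.lookup a k"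
  by (simp add: scale_def Poly_Mapping.map.rep_eq when_def)

lemma keys_scale_subset: "Poly_Mapping.keys (scale c a) \<subseteq> Poly_Mapping.keys a"
  by (auto simp: in_keys_iff lookup_scale)

lemma scale_single: "scale c (Poly_Mapping.single k x) = Poly_Mapping.single k (c * x)"
  by (rule poly_mapping_eqI) (simp add: lookup_scale lookup_single when_def)

lemma scale_sum: "scale c (\<Sum>i\<in>A. f i) = (\<Sum>i\<in>A. scale c (f i))"
  by (rule poly_mapping_eqI) (simp add: lookup_scale lookup_sum sum_distrib_left)

lemma push_single: "push F (Poly_Mapping.single C x) = Poly_Mapping.single (F C) x"
  by (cases "x = 0") (simp_all add: push_def)

lemma push_add: "push F (a + b) = push F a + push F b"
proof -
  let ?K = "Poly_Mapping.keys a \<union> Poly_Mapping.keys b"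
  have "push F x = (\<Sum>C\<in>?K. Poly_Mapping.single (F C) (Poly_Mapping.lookup x C))"
    if "x \<in> {a, b, a + b}" for x
    by (rule push_superset) (use that keys_add[of a b] in auto)
  then show ?thesis
    by (simp add: lookup_add single_add sum.distrib)
qed

lemma push_sum: "push F (\<Sum>i\<in>A. f i) = (\<Sum>i\<in>A. push F (f i))"
  by (induction A rule: infinite_finite_induct) (simp_all add: push_add push_def[of F 0])

lemma push_scale: "push F (scale c a) = scale c (push F a)"
proof -
  have "push F (scale c a) =
      (\<Sum>C\<in>Poly_Mapping.keys a. Poly_Mapping.single (F C) (Poly_Mapping.lookup (scale c a) C))"
    by (rule push_superset) (simp_all add: keys_scale_subset)
  then show ?thesis
    by (simp add: push_def scale_sum scale_single lookup_scale)
qed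

text \<open>One-sided and restricted to the support, so that it serves for both composites of
  \<open>F\<close> with \<open>inv_into X F\<close>.\<close>

lemma push_push_cancel:
  assumes "\<And>D. D \<in> Poly_Mapping.keys b \<Longrightarrow> F (G D) = D"
  shows "push F (push G b) = b"
proof -
  have "push F (push G b) =
      (\<Sum>D\<in>Poly_Mapping.keys b. Poly_Mapping.single D (Poly_Mapping.lookup b D))"
    by (simp add: push_def[of G] push_sum push_single assms)
  also have "\<dots> = b"
    by (rule poly_mapping_eqI)
      (auto simp: lookup_sum lookup_single when_def sum.delta in_keys_iff)
  finally show ?thesis .
qed

lemma lookup_push:
  assumes "inj_on F X" "Poly_Mapping.keys a \<subseteq> X" "C \<in> X"
  shows "Poly_Mapping.lookup (push F a) (F C) = Poly_Mapping.lookup a C"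
proof -
  have "Poly_Mapping.lookup (push F a) (F C) =
      (\<Sum>D\<in>Poly_Mapping.keys a. if D = C then Poly_Mapping.lookup a D else 0)"
    unfolding push_def lookup_sum lookup_single when_def
    by (rule sum.cong) (use assms in \<open>auto simp: inj_on_def\<close>)
  then show ?thesis
    by (simp add: sum.delta in_keys_iff)
qed

lemma keys_push:
  assumes "inj_on F X" "Poly_Mapping.keys a \<subseteq> X"
  shows "Poly_Mapping.keys (push F a) = F ` Poly_Mapping.keys a"
proof
  show "Poly_Mapping.keys (push F a) \<subseteq> F ` Poly_Mapping.keys a"
    unfolding push_def by (rule order_trans[OF keys_sum]) (auto split: if_splits)
  show "F ` Poly_Mapping.keys a \<subseteq> Poly_Mapping.keys (push F a)"
    using assms lookup_push[OF assms] by (auto simp: in_keys_iff subset_iff)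
qed

text \<open>Products in \<open>algebra_on\<close> are bilinear extensions, so multiplicativity is
  checked on basis elements only; the inverse is the push along the inverse of
  \<open>F\<close>.\<close>

lemma push_algebra_iso:
  assumes bij: "bij_betw F X Y" and unit: "F u = v"
    and hom: "\<And>C D. C \<in> X \<Longrightarrow> D \<in> X \<Longrightarrow> q (F C) (F D) = push F (p C D)"
  shows "push F \<in> algebra_iso (algebra_on X p u) (algebra_on Y q v)"
proof -
  let ?G = "inv_into X F"
  have inj: "inj_on F X" and img: "F ` X = Y" using bij by (auto simp: bij_betw_def)
  have injG: "inj_on ?G Y" using img inj_on_inv_into by blast
  have carr: "Poly_Mapping.keys (push F a) \<subseteq> Y" if "Poly_Mapping.keys a \<subseteq> X" for a
    using keys_push[OF inj that] that img by auto
  have carrG: "Poly_Mapping.keys (push ?G b) \<subseteq> X" if "Poly_Mapping.keys b \<subseteq> Y" for b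
    using keys_push[OF injG that] that img by (auto intro: inv_into_into)
  have bij': "bij_betw (push F) {a. Poly_Mapping.keys a \<subseteq> X} {b. Poly_Mapping.keys b \<subseteq> Y}"
  proof (rule bij_betwI[where g = "push ?G"])
    show "push ?G (push F a) = a" if "a \<in> {a. Poly_Mapping.keys a \<subseteq> X}" for a
      by (rule push_push_cancel) (use that inj in auto)
    show "push F (push ?G b) = b" if "b \<in> {b. Poly_Mapping.keys b \<subseteq> Y}" for b
      by (rule push_push_cancel) (use that img in \<open>auto intro!: f_inv_into_f\<close>)
  qed (use carr carrG in auto)
  have mult: "push F (\<Sum>C\<in>Poly_Mapping.keys a. \<Sum>D\<in>Poly_Mapping.keys b.
        scale (Poly_Mapping.lookup a C * Poly_Mapping.lookup b D) (p C D)) =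
      (\<Sum>C\<in>Poly_Mapping.keys (push F a). \<Sum>D\<in>Poly_Mapping.keys (push F b).
        scale (Poly_Mapping.lookup (push F a) C * Poly_Mapping.lookup (push F b) D) (q C D))"
    if a: "Poly_Mapping.keys a \<subseteq> X" and b: "Poly_Mapping.keys b \<subseteq> X" for a b
  proof -
    have injs: "inj_on F (Poly_Mapping.keys a)" "inj_on F (Poly_Mapping.keys b)"
      using inj a b inj_on_subset by blast+
    show ?thesis
      \<comment> \<open>The supports of the pushed factors are images under \<open>F\<close>; the
        double sum is reindexed to the original supports and compared termwise.\<close>
      unfolding keys_push[OF inj a] keys_push[OF inj b] sum.reindex[OF injs(1)]
        sum.reindex[OF injs(2)] push_sum push_scale comp_def
      by (intro sum.cong refl) (use a b in \<open>auto simp: lookup_push[OF inj] hom subset_iff\<close>)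
  qed
  show ?thesis
    unfolding algebra_iso_def ring_iso_def ring_hom_def algebra_on_def
    using bij' carr mult by (auto simp: push_add push_scale unit basis_def push_single)
qed

section \<open>Block sizes in an arc-shuffle\<close>

text \<open>Relabelling is injective on the ground set, hence on every block. The set of sizes,
  without multiplicities, is all that a maximum or minimum sees.\<close>

lemma card_image_shift:
  assumes "finite (\<Union>\<pi>)" "finite S" "card S = psize \<pi>"
  shows "card ` shift S \<pi> = card ` \<pi>"
proof -
  have "inj_on (relabel (\<Union>\<pi>) S) (\<Union>\<pi>)"
    using bij_betw_relabel[of "\<Union>\<pi>" S] assms by (simp add: psize_def bij_betw_def)
  then have "card (relabel (\<Union>\<pi>) S ` B) = card B" if "B \<in> \<pi>" for B
    using that by (intro card_image) (auto elim: inj_on_subset)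
  then show ?thesis
    unfolding shift_def image_image by (rule image_cong[OF refl])
qed

text \<open>Used to move a partition onto fresh labels, which yields disjoint representatives of two
  classes.\<close>

lemma shift_set_partitions:
  assumes "\<pi> \<in> set_partitions" "finite S" "card S = psize \<pi>" "0 \<notin> S"
  shows "shift S \<pi> \<in> set_partitions"
proof -
  have fin: "finite (\<Union>\<pi>)" using assms(1) by (rule finite_Union_partition)
  have part: "partition_on (\<Union>\<pi>) \<pi>"
    using assms(1) by (auto simp: set_partitions_def partition_on_def)
  have inj: "inj_on (relabel (\<Union>\<pi>) S) (\<Union>\<pi>)"
    using bij_betw_relabel[of "\<Union>\<pi>" S] assms fin by (simp add: psize_def bij_betw_def)
  have "partition_on S (shift S \<pi>)"
  proof (rule partition_onI)
    show "\<Union>(shift S \<pi>) = S" using Union_shift fin assms by blast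
    show "{} \<notin> shift S \<pi>"
      using part by (auto simp: shift_def partition_on_def)
    show "disjnt p p'" if p: "p \<in> shift S \<pi>" "p' \<in> shift S \<pi>" "p \<noteq> p'" for p p'
    proof -
      obtain B B' where B: "B \<in> \<pi>" "B' \<in> \<pi>" "p = relabel (\<Union>\<pi>) S ` B" "p' = relabel (\<Union>\<pi>) S ` B'"
        using p by (auto simp: shift_def)
      then have "B \<inter> B' = {}"
        using p part by (auto simp: partition_on_def disjoint_def)
      then have "p \<inter> p' = {}"
        using inj_on_image_Int[OF inj, of B B'] B by auto
      then show ?thesis by (simp add: disjnt_def)
    qed
  qed
  then show ?thesis using assms by (auto simp: set_partitions_def)
qed

lemma card_image_arc_shuffle:
  assumes "\<tau> \<in> set_partitions" "\<theta> \<in> set_partitions" "disjoint_partitions \<tau> \<theta>"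
    and "\<pi> \<in># arc_shuffle \<tau> \<theta>"
  shows "card ` \<pi> = card ` \<tau> \<union> card ` \<theta>"
proof -
  let ?U = "\<Union>\<tau> \<union> \<Union>\<theta>"
  have fin: "finite (\<Union>\<tau>)" "finite (\<Union>\<theta>)" using assms finite_Union_partition by blast+
  then have finU: "finite ?U" by blast
  then have "finite {S. S \<subseteq> ?U \<and> card S = card (\<Union>\<tau>)}" by simp
  with assms(4) obtain S where S: "S \<subseteq> ?U" "card S = card (\<Union>\<tau>)"
    and \<pi>: "\<pi> = shift S \<tau> \<union> shift (?U - S) \<theta>"
    unfolding arc_shuffle_def by auto
  have fS: "finite S" using S finU finite_subset by blast
  have cU: "card ?U = card (\<Union>\<tau>) + card (\<Union>\<theta>)"
    using assms(3) fin unfolding disjoint_partitions_def by (simp add: card_Un_disjoint)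
  have "card (?U - S) = psize \<theta>"
    using card_Diff_subset[OF fS S(1)] S(2) cU by (simp add: psize_def)
  then show ?thesis
    using \<pi> card_image_shift[of \<tau> S] card_image_shift[of \<theta> "?U - S"] fin fS finU S
    by (simp add: image_Un psize_def)
qed

text \<open>Terms are indexed by the subsets \<open>S\<close> and kept with multiplicity, so this
  counts subsets of fixed size.\<close>

lemma size_arc_shuffle:
  assumes "\<tau> \<in> set_partitions" "\<theta> \<in> set_partitions" "disjoint_partitions \<tau> \<theta>"
  shows "size (arc_shuffle \<tau> \<theta>) = (psize \<tau> + psize \<theta>) choose psize \<tau>"
proof -
  have fin: "finite (\<Union>\<tau>)" "finite (\<Union>\<theta>)" using assms finite_Union_partition by blast+
  then have "card (\<Union>\<tau> \<union> \<Union>\<theta>) = psize \<tau> + psize \<theta>"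
    using assms(3) by (simp add: card_Un_disjoint disjoint_partitions_def psize_def)
  then show ?thesis
    using fin n_subsets[of "\<Union>\<tau> \<union> \<Union>\<theta>" "psize \<tau>"]
    by (simp add: arc_shuffle_def psize_def)
qed

lemma image_mset_eq_replicate:
  assumes "\<And>x. x \<in># M \<Longrightarrow> f x = c"
  shows "image_mset f M = replicate_mset (size M) c"
  using image_mset_cong[of M f "\<lambda>_. c"] assms by (simp add: image_mset_const_eq)

lemma image_mset_arc_shuffle:
  assumes "\<tau> \<in> set_partitions" "\<theta> \<in> set_partitions" "disjoint_partitions \<tau> \<theta>"
    and "\<And>\<pi>. card ` \<pi> = card ` \<tau> \<union> card ` \<theta> \<Longrightarrow> st \<pi> = c"
  shows "image_mset st (arc_shuffle \<tau> \<theta>) =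
    replicate_mset ((psize \<tau> + psize \<theta>) choose psize \<tau>) c"
  unfolding size_arc_shuffle[OF assms(1-3), symmetric]
  by (rule image_mset_eq_replicate) (rule assms(4)[OF card_image_arc_shuffle[OF assms(1-3)]])

lemma card_image_std_eq:
  assumes "\<tau> \<in> set_partitions" "\<theta> \<in> set_partitions" "std \<tau> = std \<theta>"
  shows "card ` \<tau> = card ` \<theta>"
  using assms card_image_shift[of \<tau> "{1..psize \<tau>}"] card_image_shift[of \<theta> "{1..psize \<theta>}"]
  by (simp add: std_def finite_Union_partition)

text \<open>The statistic is then constant on each arc-shuffle, and the number of terms depends only
  on the sizes. \<open>g\<close> also receives the sizes because \<open>minBk\<close> must recognise
  empty factors.\<close>

lemma shuffle_compatibleI:
  assumes "\<And>\<pi> \<pi>'. card ` \<pi> = card ` \<pi>' \<Longrightarrow> st \<pi> = st \<pi>'"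
    and "\<And>\<tau> \<theta> \<pi>. \<tau> \<in> set_partitions \<Longrightarrow> \<theta> \<in> set_partitions \<Longrightarrow>
      card ` \<pi> = card ` \<tau> \<union> card ` \<theta> \<Longrightarrow> st \<pi> = g (psize \<tau>) (psize \<theta>) (st \<tau>) (st \<theta>)"
  shows "shuffle_compatible st"
proof -
  have eq: "image_mset st (arc_shuffle \<tau> \<theta>) = replicate_mset ((psize \<tau> + psize \<theta>) choose psize \<tau>)
      (g (psize \<tau>) (psize \<theta>) (st \<tau>) (st \<theta>))"
    if "\<tau> \<in> set_partitions" "\<theta> \<in> set_partitions" "disjoint_partitions \<tau> \<theta>" for \<tau> \<theta>
    by (rule image_mset_arc_shuffle[OF that assms(2)[OF that(1,2)]])
  show ?thesis
    unfolding shuffle_compatible_def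
  proof (intro conjI ballI impI)
    show "st \<tau> = st \<theta>" if "\<tau> \<in> set_partitions" "\<theta> \<in> set_partitions" "std \<tau> = std \<theta>" for \<tau> \<theta>
      using card_image_std_eq[OF that] by (rule assms(1))
  qed (simp add: eq)
qed

section \<open>The statistics \<open>maxBk\<close> and \<open>minBk\<close>\<close>

lemma empty_in_set_partitions: "{} \<in> set_partitions"
  unfolding set_partitions_def by (intro CollectI exI[of _ "{}"]) (simp add: partition_on_def)

lemma finite_partition: "\<pi> \<in> set_partitions \<Longrightarrow> finite \<pi>"
  using finite_Union_partition finite_UnionD by blast

lemma psize_eq_0_iff: "\<pi> \<in> set_partitions \<Longrightarrow> psize \<pi> = 0 \<longleftrightarrow> \<pi> = {}"
  using finite_Union_partition[of \<pi>]
  by (auto simp: psize_def set_partitions_def partition_on_def)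

lemma maxBk_cong:
  assumes "card ` \<pi> = card ` \<pi>'"
  shows "maxBk \<pi> = maxBk \<pi>'"
proof -
  have "\<pi> = {} \<longleftrightarrow> \<pi>' = {}" using assms by (metis image_is_empty)
  then show ?thesis using assms by (simp add: maxBk_def)
qed

text \<open>The default 0 for the empty partition is neutral for \<open>max\<close>, so the formula
  needs no exception.\<close>

lemma maxBk_Un:
  assumes "\<tau> \<in> set_partitions" "\<theta> \<in> set_partitions" "card ` \<pi> = card ` \<tau> \<union> card ` \<theta>"
  shows "maxBk \<pi> = max (maxBk \<tau>) (maxBk \<theta>)"
proof -
  have fin: "finite \<tau>" "finite \<theta>"
    using assms finite_partition by auto
  consider "\<tau> = {}" | "\<theta> = {}" | "\<tau> \<noteq> {}" "\<theta> \<noteq> {}" by blast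
  then show ?thesis
  proof cases
    case 1
    then have "maxBk \<pi> = maxBk \<theta>" using assms(3) by (intro maxBk_cong) simp
    then show ?thesis using 1 by (simp add: maxBk_def)
  next
    case 2
    then have "maxBk \<pi> = maxBk \<tau>" using assms(3) by (intro maxBk_cong) simp
    then show ?thesis using 2 by (simp add: maxBk_def)
  next
    case 3
    then have "\<pi> \<noteq> {}" using assms(3) by (metis Un_empty image_is_empty)
    then show ?thesis using 3 fin assms by (simp add: maxBk_def Max_Un)
  qed
qed

lemma minBk_cong:
  assumes "card ` \<pi> = card ` \<pi>'"
  shows "minBk \<pi> = minBk \<pi>'"
proof -
  have "\<pi> = {} \<longleftrightarrow> \<pi>' = {}" using assms by (metis image_is_empty)
  then show ?thesis using assms by (simp add: minBk_def)
qed

text \<open>Here the default 0 would absorb the other value under \<open>min\<close>, so empty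
  factors are singled out by their size.\<close>

lemma minBk_Un:
  assumes "\<tau> \<in> set_partitions" "\<theta> \<in> set_partitions" "card ` \<pi> = card ` \<tau> \<union> card ` \<theta>"
  shows "minBk \<pi> = (if psize \<tau> = 0 then minBk \<theta> else if psize \<theta> = 0 then minBk \<tau>
    else min (minBk \<tau>) (minBk \<theta>))"
proof -
  have fin: "finite \<tau>" "finite \<theta>"
    using assms finite_partition by auto
  consider "\<tau> = {}" | "\<theta> = {}" | "\<tau> \<noteq> {}" "\<theta> \<noteq> {}" by blast
  then show ?thesis
  proof cases
    case 1
    then have "minBk \<pi> = minBk \<theta>" using assms(3) by (intro minBk_cong) simp
    then show ?thesis using 1 by (simp add: minBk_def psize_def)
  next
    case 2
    then have "minBk \<pi> = minBk \<tau>" using assms(3) by (intro minBk_cong) simp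
    then show ?thesis using 2 psize_eq_0_iff[OF assms(1)] by (auto simp: minBk_def psize_def)
  next
    case 3
    then have "\<pi> \<noteq> {}" using assms(3) by (metis Un_empty image_is_empty)
    then show ?thesis using 3 fin assms by (simp add: minBk_def Min_Un psize_eq_0_iff)
  qed
qed

lemma shuffle_compatible_maxBk: "shuffle_compatible maxBk"
  by (rule shuffle_compatibleI[where g = "\<lambda>_ _. max"]) (erule maxBk_cong, rule maxBk_Un)

lemma shuffle_compatible_minBk: "shuffle_compatible minBk"
  by (rule shuffle_compatibleI[where
        g = "\<lambda>n m k l. if n = 0 then l else if m = 0 then k else min k l"])
    (erule minBk_cong, rule minBk_Un)

section \<open>The range of the maximal block size\<close>

lemma maxBk_bounds:
  assumes "\<pi> \<in> set_partitions" "\<pi> \<noteq> {}"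
  shows "1 \<le> maxBk \<pi>" "maxBk \<pi> \<le> psize \<pi>"
proof -
  have fin: "finite \<pi>" "finite (\<Union>\<pi>)"
    using assms finite_partition finite_Union_partition by blast+
  have "maxBk \<pi> \<in> card ` \<pi>"
    using fin assms Max_in[of "card ` \<pi>"] by (simp add: maxBk_def)
  then obtain B where B: "B \<in> \<pi>" "maxBk \<pi> = card B" by auto
  then have "B \<noteq> {}" using assms(1) by (auto simp: set_partitions_def partition_on_def)
  moreover have "finite B" using B(1) fin(2) by (meson Union_upper finite_subset)
  ultimately show "1 \<le> maxBk \<pi>" using B(2) by (simp add: Suc_le_eq card_gt_0_iff)
  show "maxBk \<pi> \<le> psize \<pi>"
    unfolding psize_def B(2) by (rule card_mono) (use B fin in auto)
qed

lemma maxBk_le_psize: "\<pi> \<in> set_partitions \<Longrightarrow> maxBk \<pi> \<le> psize \<pi>"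
  by (cases "\<pi> = {}") (simp_all add: maxBk_bounds(2), simp add: maxBk_def)

lemma exists_partition:
  assumes "1 \<le> k" "k \<le> n"
  obtains \<pi> where "\<pi> \<in> set_partitions" "maxBk \<pi> = k" "psize \<pi> = n"
proof -
  \<comment> \<open>One block of size \<open>k\<close>, all other elements as singletons.\<close>
  define \<pi> where "\<pi> = insert {1..k} ((\<lambda>i. {i}) ` {k<..n})"
  have U: "\<Union>\<pi> = {1..n}"
  proof -
    have "\<Union>\<pi> = {1..k} \<union> {k<..n}" unfolding \<pi>_def by blast
    also have "\<dots> = {1..n}" using assms by (intro ivl_disj_un)
    finally show ?thesis .
  qed
  have "partition_on {1..n} \<pi>"
  proof (rule partition_onI[OF U])
    show "disjnt p q" if "p \<in> \<pi>" "q \<in> \<pi>" "p \<noteq> q" for p q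
      using that unfolding \<pi>_def by (fastforce simp: disjnt_def)
    show "{} \<notin> \<pi>" using assms by (simp add: \<pi>_def image_iff)
  qed
  then have "\<pi> \<in> set_partitions"
    unfolding set_partitions_def by (intro CollectI exI[of _ "{1..n}"]) simp
  moreover have "psize \<pi> = n" unfolding psize_def U by simp
  moreover have "Max (card ` \<pi>) = k"
    unfolding \<pi>_def by (rule Max_eqI) (use assms in auto)
  then have "maxBk \<pi> = k" by (simp add: maxBk_def \<pi>_def)
  ultimately show ?thesis using that by blast
qed

section \<open>Displacements in a shifted shuffle\<close>

definition spot :: "nat set \<Rightarrow> nat \<Rightarrow> nat" where
  "spot Occ a = (LEAST s. a \<le> s \<and> s \<notin> Occ)"

text \<open>A recursive form of \<open>maxDisp\<close> with an arbitrary set of occupied spots, as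
  the inductions require. Ending in 0 is harmless because displacements are natural numbers.\<close>

primrec disp :: "nat set \<Rightarrow> nat list \<Rightarrow> nat" where
  "disp Occ [] = 0"
| "disp Occ (a # \<alpha>) = max (spot Occ a - a) (disp (insert (spot Occ a) Occ) \<alpha>)"

lemma disp_eq_Max:
  "\<alpha> \<noteq> [] \<Longrightarrow> disp Occ \<alpha> = Max (set (map2 (\<lambda>s a. s - a) (park Occ \<alpha>) \<alpha>))"
proof (induction \<alpha> arbitrary: Occ)
  case (Cons a \<alpha>)
  define S where "S = set (map2 (\<lambda>s a. s - a) (park (insert (spot Occ a) Occ) \<alpha>) \<alpha>)"
  have "Max (insert (spot Occ a - a) S) = disp Occ (a # \<alpha>)"
  proof (cases "\<alpha> = []")
    case True
    then show ?thesis by (simp add: S_def)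
  next
    case False
    then have "S \<noteq> {}" by (cases \<alpha>) (simp_all add: S_def Let_def)
    then show ?thesis using Cons.IH[OF False] by (simp add: S_def)
  qed
  then show ?case by (simp add: S_def Let_def spot_def)
qed simp

lemma maxDisp_eq_disp: "maxDisp \<alpha> = disp {} \<alpha>"
  by (simp add: maxDisp_def disp_eq_Max)

lemma spot:
  assumes "finite Occ"
  shows "a \<le> spot Occ a" "spot Occ a \<notin> Occ" "\<And>t. a \<le> t \<Longrightarrow> t < spot Occ a \<Longrightarrow> t \<in> Occ"
proof -
  obtain s where "s \<ge> a" "s \<notin> Occ"
    using assms by (metis finite_nat_set_iff_bounded_le linorder_linear not_less_eq_eq)
  then have "a \<le> s \<and> s \<notin> Occ" by simp
  then have "a \<le> spot Occ a \<and> spot Occ a \<notin> Occ"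
    unfolding spot_def by (rule LeastI)
  then show "a \<le> spot Occ a" "spot Occ a \<notin> Occ" by auto
  show "t \<in> Occ" if "a \<le> t" "t < spot Occ a" for t
    using that not_less_Least[of t "\<lambda>s. a \<le> s \<and> s \<notin> Occ"] by (simp add: spot_def)
qed

lemma spot_eqI:
  assumes "a \<le> s" "s \<notin> Occ" "\<And>t. a \<le> t \<Longrightarrow> t < s \<Longrightarrow> t \<in> Occ"
  shows "spot Occ a = s"
  unfolding spot_def by (rule Least_equality) (use assms in \<open>auto simp: not_less[symmetric]\<close>)

text \<open>Hall's condition: enough of the spots up to \<open>n\<close> are free for the remaining cars. It is kept
  by parking, and ensures that no car leaves the street.\<close>

definition fits :: "nat \<Rightarrow> nat set \<Rightarrow> nat list \<Rightarrow> bool" where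
  "fits n Occ \<alpha> \<longleftrightarrow> finite Occ \<and> (\<forall>a\<in>set \<alpha>. 1 \<le> a) \<and>
    (\<forall>j\<le>n. card (Occ \<inter> {j<..n}) + length (filter (\<lambda>a. j < a) \<alpha>) \<le> n - j)"

lemma fits_Cons:
  assumes "fits n Occ (a # \<alpha>)"
  shows "spot Occ a \<le> n" "fits n (insert (spot Occ a) Occ) \<alpha>"
proof -
  define s where "s = spot Occ a"
  have fin: "finite Occ" and a1: "1 \<le> a"
    and hall: "\<And>j. j \<le> n \<Longrightarrow>
      card (Occ \<inter> {j<..n}) + length (filter (\<lambda>a. j < a) (a # \<alpha>)) \<le> n - j"
    using assms unfolding fits_def by auto
  have s: "a \<le> s" "s \<notin> Occ" "\<And>t. a \<le> t \<Longrightarrow> t < s \<Longrightarrow> t \<in> Occ"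
    using spot[OF fin] by (auto simp: s_def)
  \<comment> \<open>At \<open>j = n\<close> the bound is 0, so no remaining car prefers a spot
    beyond \<open>n\<close>.\<close>
  have an: "a \<le> n" using hall[of n] by (auto split: if_splits)
  \<comment> \<open>The condition at \<open>a - 1\<close> concerns the spots from \<open>a\<close>
    on; the extra 1 is the arriving car itself.\<close>
  have hall': "card (Occ \<inter> {a-1<..n}) + length (filter (\<lambda>b. a - 1 < b) \<alpha>) + 1 \<le> n - (a - 1)"
    using hall[of "a - 1"] an a1 by auto
  show sn: "spot Occ a \<le> n"
  proof (rule ccontr)
    assume "\<not> spot Occ a \<le> n"
    \<comment> \<open>Otherwise all of \<open>a\<close>, ..., \<open>n\<close> would be occupied,
      leaving no room for that 1.\<close>
    then have "Occ \<inter> {a-1<..n} = {a-1<..n}" using s(3) by (auto simp: s_def)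
    then show False using hall' by simp
  qed
  have "card (insert s Occ \<inter> {j<..n}) + length (filter (\<lambda>b. j < b) \<alpha>) \<le> n - j" if "j \<le> n" for j
  proof -
    \<comment> \<open>For \<open>s \<le> j\<close> nothing is added on the left. For
      \<open>j < a\<close> the car just moves from the waiting ones to the occupied spots. In
      between, \<open>s\<close> is newly counted although \<open>a\<close> was not, and the bound
      comes from \<open>hall'\<close>.\<close>
    consider "s \<le> j" | "j < a" | "a \<le> j" "j < s" by linarith
    then show ?thesis
    proof cases
      case 1
      then have "insert s Occ \<inter> {j<..n} = Occ \<inter> {j<..n}" by auto
      then show ?thesis using hall[OF that] by (auto split: if_splits)
    next
      case 2
      then have "insert s Occ \<inter> {j<..n} = insert s (Occ \<inter> {j<..n})"
        using s(1) sn by (auto simp: s_def)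
      then show ?thesis using hall[OF that] 2 s(2) fin by auto
    next
      case 3
      then have i: "insert s Occ \<inter> {j<..n} = insert s (Occ \<inter> {j<..n})"
        using s(1) sn by (auto simp: s_def)
      \<comment> \<open>The spots \<open>a\<close>, ..., \<open>j\<close> are all occupied, so
        removing them from both sides of \<open>hall'\<close> gives the bound at
        \<open>j\<close>.\<close>
      have "Occ \<inter> {a-1<..n} = {a-1<..j} \<union> (Occ \<inter> {j<..n})"
        using 3 s(3) a1 that by auto
      moreover have "card ({a-1<..j} \<union> (Occ \<inter> {j<..n})) = (j - (a - 1)) + card (Occ \<inter> {j<..n})"
        by (subst card_Un_disjoint) (use fin in auto)
      moreover have "length (filter (\<lambda>b. j < b) \<alpha>) \<le> length (filter (\<lambda>b. a - 1 < b) \<alpha>)"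
        using 3 by (induction \<alpha>) auto
      ultimately show ?thesis using hall' i s(2) fin 3 a1 by auto
    qed
  qed
  then show "fits n (insert (spot Occ a) Occ) \<alpha>"
    using assms by (auto simp: fits_def s_def)
qed

text \<open>A car with preference at least 1 parks at a spot at most \<open>n\<close>.\<close>

lemma disp_less:
  assumes "fits n Occ \<alpha>" "0 < n"
  shows "disp Occ \<alpha> < n"
  using assms(1)
proof (induction \<alpha> arbitrary: Occ)
  case (Cons a \<alpha>)
  have "1 \<le> a" using Cons.prems by (simp add: fits_def)
  then show ?case
    using Cons.IH[OF fits_Cons(2)[OF Cons.prems]] fits_Cons(1)[OF Cons.prems] by auto
qed (use assms in simp)

text \<open>\<open>O1\<close> and \<open>O2\<close> hold the spots taken by cars of the two words.
  They stay on opposite sides of \<open>n\<close>, so each car searches as if the other word were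
  absent.\<close>

lemma disp_shuffles:
  assumes "fits n O1 \<alpha>" "\<forall>b\<in>set \<beta>. n < b" "finite O2" "O1 \<subseteq> {..n}" "O2 \<subseteq> {n<..}"
    and "\<gamma> \<in> shuffles \<alpha> \<beta>"
  shows "disp (O1 \<union> O2) \<gamma> = max (disp O1 \<alpha>) (disp O2 \<beta>)"
  using assms
proof (induction \<gamma> arbitrary: \<alpha> \<beta> O1 O2)
  case (Cons c \<gamma>)
  have fin: "finite O1" using Cons.prems by (simp add: fits_def)
  from Cons.prems(6) consider \<alpha>' where "\<alpha> = c # \<alpha>'" "\<gamma> \<in> shuffles \<alpha>' \<beta>"
    | \<beta>' where "\<beta> = c # \<beta>'" "\<gamma> \<in> shuffles \<alpha> \<beta>'"
    by (auto simp: Cons_in_shuffles_iff neq_Nil_conv)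
  then show ?case
  proof cases
    case 1
    let ?s = "spot O1 c"
    have f: "?s \<le> n" "fits n (insert ?s O1) \<alpha>'"
      using fits_Cons Cons.prems(1) 1 by blast+
    \<comment> \<open>The search in \<open>O1\<close> stops by \<open>n\<close>, before it could
      meet \<open>O2\<close>.\<close>
    have s: "spot (O1 \<union> O2) c = ?s"
      by (rule spot_eqI) (use spot[OF fin] f(1) Cons.prems(5) in auto)
    have "disp (insert ?s O1 \<union> O2) \<gamma> = max (disp (insert ?s O1) \<alpha>') (disp O2 \<beta>)"
      by (rule Cons.IH) (use Cons.prems f 1 in auto)
    then show ?thesis using 1 s by (simp add: max.assoc)
  next
    case 2
    let ?s = "spot O2 c"
    have sp: "c \<le> ?s" "?s \<notin> O2" "\<And>t. c \<le> t \<Longrightarrow> t < ?s \<Longrightarrow> t \<in> O2"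
      using spot[OF Cons.prems(3)] by auto
    have c: "n < c" using Cons.prems 2 by simp
    \<comment> \<open>The search starts beyond \<open>n\<close>, above all of
      \<open>O1\<close>.\<close>
    have s: "spot (O1 \<union> O2) c = ?s"
      by (rule spot_eqI) (use sp c Cons.prems(4) in auto)
    have "disp (O1 \<union> insert ?s O2) \<gamma> = max (disp O1 \<alpha>) (disp (insert ?s O2) \<beta>')"
      by (rule Cons.IH) (use Cons.prems sp(1) c 2 in auto)
    then show ?thesis using 2 s by (simp add: max.left_commute)
  qed
qed auto

lemma disp_shift:
  assumes "finite Occ"
  shows "disp ((\<lambda>s. s + n) ` Occ) (map (\<lambda>b. b + n) \<beta>) = disp Occ \<beta>"
  using assms
proof (induction \<beta> arbitrary: Occ)
  case (Cons b \<beta>)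
  have s: "spot ((\<lambda>s. s + n) ` Occ) (b + n) = spot Occ b + n"
  proof (rule spot_eqI)
    show "t \<in> (\<lambda>s. s + n) ` Occ" if "b + n \<le> t" "t < spot Occ b + n" for t
      using spot(3)[OF Cons.prems, of b "t - n"] that
      by (intro image_eqI[of _ _ "t - n"]) auto
  qed (use spot[OF Cons.prems] in auto)
  show ?case
    using Cons.IH[of "insert (spot Occ b) Occ"] Cons.prems by (simp add: s)
qed simp

text \<open>In the sorted word the first \<open>j\<close> entries are at most \<open>j\<close>, so
  entries above \<open>j\<close> lie among the last \<open>length \<alpha> - j\<close>.\<close>

lemma PF_fits:
  assumes "\<alpha> \<in> PF"
  shows "fits (length \<alpha>) {} \<alpha>"
proof -
  let ?n = "length \<alpha>"
  have \<alpha>: "\<forall>a\<in>set \<alpha>. 1 \<le> a" "\<And>i. i < ?n \<Longrightarrow> sort \<alpha> ! i \<le> i + 1"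
    using assms by (auto simp: PF_def PF_n_def)
  have "length (filter (\<lambda>a. j < a) \<alpha>) \<le> ?n - j" if "j \<le> ?n" for j
  proof -
    have "\<not> j < a" if "a \<in> set (take j (sort \<alpha>))" for a
    proof -
      obtain i where i: "i < j" "i < ?n" "a = sort \<alpha> ! i"
        using \<open>a \<in> set (take j (sort \<alpha>))\<close> by (auto simp: in_set_conv_nth)
      with \<alpha>(2)[of i] show ?thesis by simp
    qed
    then have e: "filter (\<lambda>a. j < a) (take j (sort \<alpha>)) = []"
      by (simp add: filter_empty_conv)
    have "length (filter (\<lambda>a. j < a) \<alpha>) = length (filter (\<lambda>a. j < a) (sort \<alpha>))"
      by (metis filter_sort length_sort)
    also have "\<dots> = length (filter (\<lambda>a. j < a) (drop j (sort \<alpha>)))"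
      by (metis e append_Nil append_take_drop_id filter_append)
    also have "\<dots> \<le> ?n - j"
      by (rule order_trans[OF length_filter_le]) simp
    finally show ?thesis .
  qed
  then show ?thesis using \<alpha> by (auto simp: fits_def)
qed

lemma PF_entries:
  assumes "\<alpha> \<in> PF" "a \<in> set \<alpha>"
  shows "1 \<le> a" "a \<le> length \<alpha>"
proof -
  show "1 \<le> a" using assms by (auto simp: PF_def PF_n_def)
  have "filter (\<lambda>a. length \<alpha> < a) \<alpha> = []"
    using PF_fits[OF assms(1)] unfolding fits_def by fastforce
  then show "a \<le> length \<alpha>" using assms(2) by (auto simp: filter_empty_conv)
qed

lemma maxDisp_shifted_shuffle:
  assumes "\<alpha> \<in> PF" "\<beta> \<in> PF" "\<gamma> \<in> shifted_shuffle \<alpha> \<beta>"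
  shows "maxDisp \<gamma> = max (maxDisp \<alpha>) (maxDisp \<beta>)"
proof -
  have "\<forall>b\<in>set (map (\<lambda>b. b + length \<alpha>) \<beta>). length \<alpha> < b"
    using PF_entries(1)[OF assms(2)] by (auto simp: Suc_le_eq)
  \<comment> \<open>The empty street is written as a union to match
    \<open>disp_shuffles\<close>.\<close>
  then have "disp ({} \<union> {}) \<gamma> = max (disp {} \<alpha>) (disp {} (map (\<lambda>b. b + length \<alpha>) \<beta>))"
    using assms PF_fits by (intro disp_shuffles) (auto simp: shifted_shuffle_def)
  then show ?thesis
    using disp_shift[of "{}"] by (simp add: maxDisp_eq_disp)
qed

lemma card_shifted_shuffle:
  assumes "\<alpha> \<in> PF" "\<beta> \<in> PF"
  shows "card (shifted_shuffle \<alpha> \<beta>) = (length \<alpha> + length \<beta>) choose length \<alpha>"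
proof -
  have "b + length \<alpha> \<notin> set \<alpha>" if "b \<in> set \<beta>" for b
    using PF_entries(2)[OF assms(1), of "b + length \<alpha>"] PF_entries(1)[OF assms(2) that] by auto
  then have "set \<alpha> \<inter> set (map (\<lambda>b. b + length \<alpha>) \<beta>) = {}"
    by auto
  then show ?thesis
    by (simp add: shifted_shuffle_def card_disjoint_shuffles)
qed

section \<open>The two algebras\<close>

lemma length_block_word: "\<pi> \<in> set_partitions \<Longrightarrow> length (block_word \<pi>) = psize \<pi>"
  using maxBk_le_psize[of \<pi>] by (simp add: block_word_def)

lemma block_word_in_PF_n:
  assumes "\<pi> \<in> set_partitions"
  shows "block_word \<pi> \<in> PF_n (psize \<pi>)"
proof -
  have "sorted (block_word \<pi>)"
    by (auto simp: block_word_def sorted_append)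
  then show ?thesis
    using length_block_word[OF assms] maxBk_le_psize[OF assms]
    by (simp add: PF_n_def sorted_sort_id)
      (auto simp: block_word_def nth_append simp del: upt_Suc)
qed

text \<open>The \<open>Suc r\<close> cars preferring spot 1 fill \<open>j + 1\<close>, ...,
  \<open>j + r + 1\<close>, and the last one is displaced most, by \<open>j + r\<close>.\<close>

lemma disp_replicate:
  "disp {1..j} (replicate (Suc r) 1 @ w) = max (j + r) (disp {1..j + Suc r} w)"
proof -
  have s: "spot {1..j} 1 = Suc j" for j
    by (rule spot_eqI) auto
  have i: "insert (Suc j) {1..j} = {1..Suc j}" for j
    by auto
  show ?thesis
  proof (induction r arbitrary: j)
    case 0
    show ?case using s[of j] i[of j] by simp
  next
    case (Suc r)
    show ?case
      using s[of j] i[of j] Suc.IH[of "Suc j"] by (simp add: max.assoc[symmetric])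
  qed
qed

lemma disp_upt: "disp {1..k} [Suc k..<Suc k + r] = 0"
proof (induction r arbitrary: k)
  case (Suc r)
  have s: "spot {1..k} (Suc k) = Suc k"
    by (rule spot_eqI) auto
  have i: "insert (Suc k) {1..k} = {1..Suc k}"
    by auto
  have "[Suc k..<Suc k + Suc r] = Suc k # [Suc (Suc k)..<Suc (Suc k) + r]"
    by (simp add: upt_conv_Cons del: upt_Suc)
  then show ?case
    using s i Suc.IH[of "Suc k"] by (simp del: upt_Suc)
qed simp

text \<open>The last of the leading ones is displaced by \<open>maxBk \<pi> - 1\<close>, and all
  later cars get their preferred spots. Truncated subtraction covers the empty partition.\<close>

lemma maxDisp_block_word:
  assumes "\<pi> \<in> set_partitions"
  shows "maxDisp (block_word \<pi>) = maxBk \<pi> - 1"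
proof (cases "maxBk \<pi>")
  case 0
  then have "\<pi> = {}" using maxBk_bounds(1)[OF assms] by fastforce
  then show ?thesis by (simp add: block_word_def maxDisp_def maxBk_def psize_def)
next
  case (Suc k)
  then have "block_word \<pi> = replicate (Suc k) 1 @ [Suc (Suc k)..<Suc (Suc k) + (psize \<pi> - Suc k)]"
    using maxBk_le_psize[OF assms] by (simp add: block_word_def del: upt_Suc)
  then show ?thesis
    using disp_replicate[of 0 k] disp_upt[of "Suc k"] Suc
    by (simp add: maxDisp_eq_disp del: upt_Suc)
qed

section \<open>Products of basis classes\<close>

lemma sum_mset_replicate_basis:
  "sum_mset (replicate_mset n (basis C)) = Poly_Mapping.single C (of_nat n)"
  by (induction n) (simp_all add: basis_def single_add[symmetric])

text \<open>Supplies a representative of the single class occurring in a product, so that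
  \<open>class_map\<close> can be evaluated there.\<close>

lemma exists_partition_max:
  assumes "\<tau> \<in> set_partitions" "\<theta> \<in> set_partitions"
  obtains \<rho> where "\<rho> \<in> set_partitions" "maxBk \<rho> = max (maxBk \<tau>) (maxBk \<theta>)"
    "psize \<rho> = psize \<tau> + psize \<theta>"
proof (cases "\<tau> = {} \<and> \<theta> = {}")
  case True
  then show ?thesis using assms that[of "{}"] by (auto simp: psize_def)
next
  case False
  then have "1 \<le> max (maxBk \<tau>) (maxBk \<theta>)"
    using maxBk_bounds(1) assms by (auto simp: le_max_iff_disj)
  moreover have "max (maxBk \<tau>) (maxBk \<theta>) \<le> psize \<tau> + psize \<theta>"
    using maxBk_le_psize assms by (simp add: trans_le_add1 trans_le_add2)
  ultimately show ?thesis using that exists_partition by blast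
qed

lemma psi_prod_maxBk:
  assumes "\<tau> \<in> set_partitions" "\<theta> \<in> set_partitions"
    and "maxBk \<rho> = max (maxBk \<tau>) (maxBk \<theta>)" "psize \<rho> = psize \<tau> + psize \<theta>"
  shows "psi_prod maxBk (psi_class maxBk \<tau>) (psi_class maxBk \<theta>) =
    Poly_Mapping.single (psi_class maxBk \<rho>) (of_nat ((psize \<tau> + psize \<theta>) choose psize \<tau>))"
proof -
  \<comment> \<open>\<theta> is moved to labels above those of \<tau>, which makes the pair disjoint
    without changing the class. Inserting 0 keeps \<open>Max\<close> meaningful for empty
    \<tau>.\<close>
  define N where "N = Max (insert 0 (\<Union>\<tau>))"
  define S where "S = {N<..N + psize \<theta>}"
  define \<theta>' where "\<theta>' = shift S \<theta>"
  have fin: "finite (\<Union>\<tau>)" "finite (\<Union>\<theta>)" using assms finite_Union_partition by blast+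
  have S: "finite S" "card S = psize \<theta>" "0 \<notin> S" by (auto simp: S_def)
  have p: "\<theta>' \<in> set_partitions"
    unfolding \<theta>'_def by (rule shift_set_partitions) (use assms S in auto)
  have U: "\<Union>\<theta>' = S" unfolding \<theta>'_def using Union_shift fin S by blast
  have sz: "psize \<theta>' = psize \<theta>" using U S by (simp add: psize_def[of \<theta>'])
  have "card ` \<theta>' = card ` \<theta>" unfolding \<theta>'_def using card_image_shift fin S by blast
  then have mx: "maxBk \<theta>' = maxBk \<theta>" by (rule maxBk_cong)
  have "x \<le> N" if "x \<in> \<Union>\<tau>" for x
    unfolding N_def by (rule Max_ge) (use fin that in auto)
  then have disj: "disjoint_partitions \<tau> \<theta>'"
    unfolding disjoint_partitions_def U by (fastforce simp: S_def)
  have "psi_class maxBk \<pi> = psi_class maxBk \<rho>" if "\<pi> \<in># arc_shuffle \<tau> \<theta>'" for \<pi>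
    using maxBk_Un[OF assms(1) p card_image_arc_shuffle[OF assms(1) p disj that]]
      psize_arc_shuffle[OF assms(1) p disj that] assms mx sz
    by (simp add: psi_class_def)
  then have "image_mset (\<lambda>\<pi>. basis (psi_class maxBk \<pi>)) (arc_shuffle \<tau> \<theta>') =
      replicate_mset (size (arc_shuffle \<tau> \<theta>')) (basis (psi_class maxBk \<rho>))"
    by (intro image_mset_eq_replicate) simp
  moreover have "psi_class maxBk \<theta> = psi_class maxBk \<theta>'"
    using sz mx by (simp add: psi_class_def)
  ultimately show ?thesis
    using psi_prod_eq[OF shuffle_compatible_maxBk assms(1) p disj]
      size_arc_shuffle[OF assms(1) p disj]
    by (simp add: sum_mset_replicate_basis sz)
qed

lemma pf_prod_maxDisp:
  assumes "\<alpha> \<in> PF" "\<beta> \<in> PF"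
    and "maxDisp \<gamma> = max (maxDisp \<alpha>) (maxDisp \<beta>)" "length \<gamma> = length \<alpha> + length \<beta>"
  shows "pf_prod maxDisp (pf_class maxDisp \<alpha>) (pf_class maxDisp \<beta>) =
    Poly_Mapping.single (pf_class maxDisp \<gamma>) (of_nat ((length \<alpha> + length \<beta>) choose length \<alpha>))"
proof -
  \<comment> \<open>The right-hand side depends only on lengths and statistic values, which is the
    compatibility demanded by \<open>pf_prod_eq\<close>.\<close>
  have im: "image_mset maxDisp (mset_set (shifted_shuffle \<alpha>' \<beta>')) =
      replicate_mset ((length \<alpha>' + length \<beta>') choose length \<alpha>') (max (maxDisp \<alpha>') (maxDisp \<beta>'))"
    if "\<alpha>' \<in> PF" "\<beta>' \<in> PF" for \<alpha>' \<beta>'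
    by (subst image_mset_eq_replicate[where c = "max (maxDisp \<alpha>') (maxDisp \<beta>')"])
      (use that in \<open>auto simp: shifted_shuffle_def maxDisp_shifted_shuffle[unfolded shifted_shuffle_def]
        card_shifted_shuffle[unfolded shifted_shuffle_def]\<close>)
  have "pf_prod maxDisp (pf_class maxDisp \<alpha>) (pf_class maxDisp \<beta>) =
      (\<Sum>\<delta>\<in>shifted_shuffle \<alpha> \<beta>. basis (pf_class maxDisp \<delta>))"
    by (rule pf_prod_eq) (use assms in \<open>auto simp: im pf_class_def\<close>)
  also have "\<dots> = sum_mset (replicate_mset (card (shifted_shuffle \<alpha> \<beta>)) (basis (pf_class maxDisp \<gamma>)))"
  proof -
    have "pf_class maxDisp \<delta> = pf_class maxDisp \<gamma>" if "\<delta> \<in> shifted_shuffle \<alpha> \<beta>" for \<delta>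
    proof -
      have "length \<delta> = length \<gamma>"
        using that assms(4) by (auto simp: shifted_shuffle_def length_shuffles)
      then show ?thesis
        using maxDisp_shifted_shuffle[OF assms(1,2) that] assms(3) by (simp add: pf_class_def)
    qed
    then show ?thesis
      unfolding sum_unfold_sum_mset
      by (subst image_mset_eq_replicate[where c = "basis (pf_class maxDisp \<gamma>)"])
        (auto simp: shifted_shuffle_def)
  qed
  finally show ?thesis
    by (simp add: sum_mset_replicate_basis card_shifted_shuffle[OF assms(1,2)])
qed

section \<open>The correspondence of classes and the isomorphism\<close>

definition class_map :: "nat set set set \<Rightarrow> nat list set" where
  "class_map C = pf_class maxDisp (block_word (SOME \<pi>. \<pi> \<in> C))"

text \<open>The choice of representative is immaterial: \<open>block_word\<close> depends only on
  \<open>maxBk\<close> and \<open>psize\<close>, which are constant on a class.\<close>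

lemma class_map_psi_class:
  assumes "\<pi> \<in> set_partitions"
  shows "class_map (psi_class maxBk \<pi>) = pf_class maxDisp (block_word \<pi>)"
proof -
  have "\<pi> \<in> psi_class maxBk \<pi>" using assms by (simp add: psi_class_def)
  then have "(SOME \<pi>'. \<pi>' \<in> psi_class maxBk \<pi>) \<in> psi_class maxBk \<pi>" by (rule someI)
  then show ?thesis by (simp add: class_map_def psi_class_def block_word_def)
qed

lemma block_word_in_PF: "\<pi> \<in> set_partitions \<Longrightarrow> block_word \<pi> \<in> PF"
  using block_word_in_PF_n by (auto simp: PF_def)

lemma bij_betw_class_map:
  "bij_betw class_map (psi_class maxBk ` set_partitions) (pf_class maxDisp ` PF)"
proof (rule bij_betw_imageI)
  show "inj_on class_map (psi_class maxBk ` set_partitions)"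
  proof (rule inj_onI; clarify)
    fix \<pi> \<rho>
    assume \<pi>: "\<pi> \<in> set_partitions" and \<rho>: "\<rho> \<in> set_partitions"
      and eq: "class_map (psi_class maxBk \<pi>) = class_map (psi_class maxBk \<rho>)"
    have "block_word \<pi> \<in> pf_class maxDisp (block_word \<pi>)"
      using block_word_in_PF[OF \<pi>] by (simp add: pf_class_def)
    then have "block_word \<pi> \<in> pf_class maxDisp (block_word \<rho>)"
      using eq \<pi> \<rho> by (simp add: class_map_psi_class)
    then have sz: "psize \<pi> = psize \<rho>" and mx: "maxBk \<pi> - 1 = maxBk \<rho> - 1"
      using \<pi> \<rho> by (simp_all add: pf_class_def length_block_word maxDisp_block_word)
    \<comment> \<open>Truncated subtraction identifies the values 0 and 1; equality of sizes
      separates the empty partition from the others.\<close>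
    have "maxBk \<pi> = maxBk \<rho>"
    proof (cases "\<pi> = {}")
      case True
      then show ?thesis using sz psize_eq_0_iff \<pi> \<rho> by metis
    next
      case False
      then have "\<rho> \<noteq> {}" using sz psize_eq_0_iff \<pi> \<rho> by metis
      then show ?thesis
        using maxBk_bounds(1)[OF \<pi> False] maxBk_bounds(1)[OF \<rho>] mx by simp
    qed
    with sz show "psi_class maxBk \<pi> = psi_class maxBk \<rho>" by (simp add: psi_class_def)
  qed
  show "class_map ` psi_class maxBk ` set_partitions = pf_class maxDisp ` PF"
  proof (intro equalityI subsetI)
    fix D assume "D \<in> class_map ` psi_class maxBk ` set_partitions"
    then show "D \<in> pf_class maxDisp ` PF"
      using block_word_in_PF by (auto simp: class_map_psi_class)
  next
    fix D assume "D \<in> pf_class maxDisp ` PF"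
    then obtain \<alpha> where \<alpha>: "\<alpha> \<in> PF" "D = pf_class maxDisp \<alpha>" by auto
    \<comment> \<open>For nonempty \<alpha>, \<open>disp_less\<close> makes
      \<open>Suc (maxDisp \<alpha>)\<close> an admissible largest block size.\<close>
    obtain \<pi> where \<pi>: "\<pi> \<in> set_partitions" "maxBk \<pi> - 1 = maxDisp \<alpha>" "psize \<pi> = length \<alpha>"
    proof (cases "\<alpha> = []")
      case True
      then show ?thesis
        using that[of "{}"] by (simp add: empty_in_set_partitions maxBk_def maxDisp_def psize_def)
    next
      case False
      then have "maxDisp \<alpha> < length \<alpha>"
        using disp_less[OF PF_fits[OF \<alpha>(1)]] by (simp add: maxDisp_eq_disp)
      then obtain \<pi> where "\<pi> \<in> set_partitions" "maxBk \<pi> = Suc (maxDisp \<alpha>)" "psize \<pi> = length \<alpha>"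
        using exists_partition[of "Suc (maxDisp \<alpha>)" "length \<alpha>"] by (metis Suc_leI le_add1 plus_1_eq_Suc)
      then show ?thesis using that[of \<pi>] by simp
    qed
    then have "class_map (psi_class maxBk \<pi>) = D"
      using \<alpha> by (simp add: class_map_psi_class pf_class_def maxDisp_block_word length_block_word)
    with \<pi>(1) show "D \<in> class_map ` psi_class maxBk ` set_partitions" by blast
  qed
qed

text \<open>Both products are one class with the same binomial coefficient, and subtracting 1
  commutes with \<open>max\<close>.\<close>

lemma pf_prod_class_map:
  assumes "C \<in> psi_class maxBk ` set_partitions" "D \<in> psi_class maxBk ` set_partitions"
  shows "pf_prod maxDisp (class_map C) (class_map D) = push class_map (psi_prod maxBk C D)"
proof -
  obtain \<tau> \<theta> where \<tau>: "\<tau> \<in> set_partitions" "C = psi_class maxBk \<tau>"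
    and \<theta>: "\<theta> \<in> set_partitions" "D = psi_class maxBk \<theta>"
    using assms by auto
  obtain \<rho> where \<rho>: "\<rho> \<in> set_partitions" "maxBk \<rho> = max (maxBk \<tau>) (maxBk \<theta>)"
    "psize \<rho> = psize \<tau> + psize \<theta>"
    using exists_partition_max[OF \<tau>(1) \<theta>(1)] .
  have "pf_prod maxDisp (pf_class maxDisp (block_word \<tau>)) (pf_class maxDisp (block_word \<theta>)) =
      Poly_Mapping.single (pf_class maxDisp (block_word \<rho>))
        (of_nat ((length (block_word \<tau>) + length (block_word \<theta>)) choose length (block_word \<tau>)))"
    by (rule pf_prod_maxDisp)
      (use \<tau>(1) \<theta>(1) \<rho> in \<open>auto simp: block_word_in_PF maxDisp_block_word length_block_word\<close>)
  then show ?thesis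
    using \<tau> \<theta> \<rho>
    by (simp add: psi_prod_maxBk[OF \<tau>(1) \<theta>(1) \<rho>(2,3)] push_single class_map_psi_class length_block_word)
qed

theorem corollary5p21:
  shows "shuffle_compatible maxBk \<and> shuffle_compatible minBk \<and>
    (\<forall>\<pi>\<in>set_partitions. block_word \<pi> \<in> PF_n (psize \<pi>)) \<and>
    (\<exists>\<phi> \<in> algebra_iso (psi_algebra maxBk) (pf_algebra maxDisp).
      \<forall>\<pi>\<in>set_partitions.
        \<phi> (basis (psi_class maxBk \<pi>)) = basis (pf_class maxDisp (block_word \<pi>)))"
proof (intro conjI ballI bexI[of _ "push class_map"])
  show "push class_map (basis (psi_class maxBk \<pi>)) = basis (pf_class maxDisp (block_word \<pi>))"
    if "\<pi> \<in> set_partitions" for \<pi>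
    using that by (simp add: basis_def push_single class_map_psi_class)
  \<comment> \<open>Units correspond: the block word of the empty partition is empty.\<close>
  have "class_map (psi_class maxBk {}) = pf_class maxDisp []"
    by (simp add: empty_in_set_partitions class_map_psi_class block_word_def maxBk_def psize_def)
  then show "push class_map \<in> algebra_iso (psi_algebra maxBk) (pf_algebra maxDisp)"
    unfolding psi_algebra_def pf_algebra_def
    by (rule push_algebra_iso[OF bij_betw_class_map]) (rule pf_prod_class_map)
qed (simp_all add: shuffle_compatible_maxBk shuffle_compatible_minBk block_word_in_PF_n)

end
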